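(* Let $C$ be a commutative $\mathbb{Q}$-algebra, let $\lambda\in C$, and let $e_\lambda(x)=\sum_{k=1}^\infty\frac{\lambda^{k-1}x^k}{k!}\in C[[x]]$. Then the sequence of powers $\{e_\lambda^n(x)\}_{n\in\mathbb{N}}$, where $e_\lambda^n(x)=(e_\lambda(x))^n$, is a pseudo-basis of $C[[x]]$ of $\lambda$-binomial type.
   Context: $\mathbb{N}$ is the set of non-negative integers. The series $e_\lambda(x)$ is also written $\frac{e^{\lambda x}-1}{\lambda}$; for $\lambda=0$ it is $x$. A pseudo-basis of $C[[x]]$ (with its $x$-adic topology) is a sequence $\{p_n\}$ that is linearly independent and generates $C[[x]]$ as a topological $C$-module, i.e. all series $\sum_nc_np_n$ converge and every element of $C[[x]]$ is uniquely such a series. A sequence $\{p_n(x)\mid n\in\mathbb{N}\}$ in $C[[x]]$ is of $\lambda$-binomial type if for all $n\in\mathbb{N}$, $p_n(x+y)=\sum_{k=0}^n\lambda^k\sum_{i=0}^n\binom{n}{i}\binom{i}{k}p_{n+k-i}(x)p_i(y)$ in $C[[x,y]]$, where $\binom{a}{b}=0$ if $b>a\ge0$. *)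

theory Defs
  imports "HOL-Computational_Algebra.Formal_Power_Series"
begin

unbundle fps_syntax

text \<open>
  A commutative algebra over the rationals: a commutative ring with a rational vector space
  structure for which the multiplication is bilinear (by commutativity, linearity in
  the first argument suffices).
\<close>

locale comm_rat_algebra = module scale
  for scale :: "rat \<Rightarrow> 'a::comm_ring_1 \<Rightarrow> 'a" +
  assumes scale_mult_left: "scale q (x * y) = scale q x * y"

definition e_series :: "(rat \<Rightarrow> 'a::comm_ring_1 \<Rightarrow> 'a) \<Rightarrow> 'a \<Rightarrow> 'a fps" where
  "e_series scale l = Abs_fps (\<lambda>k. if k = 0 then 0 else scale (1 / fact k) (l ^ (k - 1)))"

text \<open>
  The topology on \<^typ>\<open>'a fps\<close> is the library's X-adic metric topology. Uniqueness of the
  coefficient sequence for the zero series contains linear independence of the sequence.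
\<close>

definition pseudo_basis :: "(nat \<Rightarrow> 'a::comm_ring_1 fps) \<Rightarrow> bool" where
  "pseudo_basis p \<longleftrightarrow>
     (\<forall>c :: nat \<Rightarrow> 'a. summable (\<lambda>n. fps_const (c n) * p n)) \<and>
     (\<forall>f. \<exists>!c :: nat \<Rightarrow> 'a. (\<lambda>n. fps_const (c n) * p n) sums f)"

text \<open>
  Series in two variables x, y are represented by \<^typ>\<open>'a fps fps\<close>, i.e. as series in y whose
  coefficients are series in x: the coefficient of \<open>x ^ i * y ^ j\<close> in \<open>F\<close> is \<open>F $ j $ i\<close>.
\<close>

definition var_x :: "'a::comm_ring_1 fps fps" where
  "var_x = fps_const fps_X"

definition var_y :: "'a::comm_ring_1 fps fps" where
  "var_y = fps_X"

definition in_x :: "'a::comm_ring_1 fps \<Rightarrow> 'a fps fps" where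
  "in_x f = fps_const f"

definition in_y :: "'a::comm_ring_1 fps \<Rightarrow> 'a fps fps" where
  "in_y f = Abs_fps (\<lambda>j. fps_const (f $ j))"

text \<open>
  The series \<open>f (x + y) = (\<Sum>n. f $ n * (x + y) ^ n)\<close>. Since \<open>(x + y) ^ n\<close> is homogeneous of
  degree n, only finitely many terms (those with \<open>n \<le> i + j\<close>) contribute to the coefficient
  of \<open>x ^ i * y ^ j\<close>. The operation \<^const>\<open>fps_compose\<close> cannot be used here, because
  \<open>var_x + var_y\<close> has non-zero constant coefficient as a series in y.
\<close>

definition in_x_plus_y :: "'a::comm_ring_1 fps \<Rightarrow> 'a fps fps" where
  "in_x_plus_y f =
     Abs_fps (\<lambda>j. Abs_fps (\<lambda>i. \<Sum>n\<le>i + j. f $ n * ((var_x + var_y) ^ n $ j $ i)))"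

lemma var_x_plus_var_y_power_nth:
  "(var_x + var_y :: 'a::comm_ring_1 fps fps) ^ n $ j $ i =
     (if n = i + j then of_nat (n choose i) else 0)"
proof -
  have c: "(of_nat m :: 'a fps fps) = fps_const (of_nat m)" for m
    by (simp only: fps_of_nat)
  have d: "(of_nat m :: 'a fps) = fps_const (of_nat m)" for m
    by (simp only: fps_of_nat)
  have t: "((of_nat m :: 'a fps fps) * fps_const fps_X ^ k * fps_X ^ r) $ j $ i =
      (if j = r \<and> i = k then of_nat m else 0)" for m k r
  proof -
    have "(of_nat m :: 'a fps fps) * fps_const fps_X ^ k * fps_X ^ r =
        fps_const (fps_const (of_nat m) * fps_X ^ k) * fps_X ^ r"
      by (simp only: c d fps_const_power fps_const_mult)
    then show ?thesis
      by (simp only: fps_mult_left_const_nth fps_X_power_nth) simp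
  qed
  have "(var_x + var_y :: 'a fps fps) ^ n $ j $ i =
      (\<Sum>k\<le>n. if j = n - k \<and> i = k then of_nat (n choose k) else 0)"
    by (simp only: binomial_ring var_x_def var_y_def fps_sum_nth t)
  also have "\<dots> = (\<Sum>k\<le>n. if k = i then (if n = i + j then of_nat (n choose i) else 0) else 0)"
    by (intro sum.cong) auto
  also have "\<dots> = (if n = i + j then of_nat (n choose i) else 0)"
    by auto
  finally show ?thesis .
qed

definition lambda_binomial_type :: "'a::comm_ring_1 \<Rightarrow> (nat \<Rightarrow> 'a fps) \<Rightarrow> bool" where
  "lambda_binomial_type l p \<longleftrightarrow>
     (\<forall>n. in_x_plus_y (p n) =
        (\<Sum>k=0..n. fps_const (fps_const (l ^ k)) *
           (\<Sum>i=0..n. of_nat (n choose i) * of_nat (i choose k) *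
              in_x (p (n + k - i)) * in_y (p i))))"

end

theory Submission
  imports Defs
begin

text \<open>
  The series \<open>e\<close> has zero constant and unit linear coefficient, so its powers are
  unitriangular with respect to \<open>1, x, x\<^sup>2, \<dots>\<close>, and a unitriangular system of linear equations
  has a unique solution. For the binomial identity, substitution of \<open>x + y\<close> is multiplicative
  and \<open>e (x + y) = e (x) + e (y) + l * e (x) * e (y)\<close>; expand the \<open>n\<close>-th power of
  \<open>e (x) + (1 + l * e (x)) * e (y)\<close> by the binomial theorem, twice.
\<close>

section \<open>Unitriangular sequences in the X-adic topology\<close>

lemma unitriangular_partial_sum_nth:
  fixes p :: "nat \<Rightarrow> 'a::comm_ring_1 fps"
  assumes "\<And>n m. m < n \<Longrightarrow> p n $ m = 0" and "m < N"
  shows "(\<Sum>n<N. fps_const (c n) * p n) $ m = (\<Sum>n\<le>m. c n * p n $ m)"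
proof -
  have "(\<Sum>n<N. c n * p n $ m) = (\<Sum>n\<le>m. c n * p n $ m)"
    by (rule sum.mono_neutral_right) (use assms in auto)
  then show ?thesis
    by (simp add: fps_sum_nth)
qed

text \<open>Distinct series have distance 2 to the minus subdegree of their difference, so a
  distance below \<open>inverse (2 ^ m)\<close> forces agreement in degree \<open>m\<close>.\<close>

lemma fps_tendsto_iff:
  fixes F :: "nat \<Rightarrow> 'a::group_add fps"
  shows "F \<longlonglongrightarrow> f \<longleftrightarrow> (\<forall>m. eventually (\<lambda>N. F N $ m = f $ m) sequentially)"
proof
  assume F: "F \<longlonglongrightarrow> f"
  show "\<forall>m. eventually (\<lambda>N. F N $ m = f $ m) sequentially"
  proof
    fix m
    have "eventually (\<lambda>N. dist (F N) f < inverse (2 ^ m)) sequentially"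
      using F by (rule tendstoD) simp
    then show "eventually (\<lambda>N. F N $ m = f $ m) sequentially"
    proof eventually_elim
      case (elim N)
      show ?case
      proof (rule ccontr)
        assume ne: "F N $ m \<noteq> f $ m"
        then have "subdegree (F N - f) \<le> m"
          by (intro subdegree_leI) simp
        moreover have "F N \<noteq> f" using ne by auto
        ultimately show False
          using elim by (simp add: dist_fps_def)
      qed
    qed
  qed
next
  assume "\<forall>m. eventually (\<lambda>N. F N $ m = f $ m) sequentially"
  then show "F \<longlonglongrightarrow> f"
    by (intro tendsto_fpsI) blast
qed

text \<open>Terms with \<open>n > m\<close> vanish in degree \<open>m\<close>, so that coefficient
  of the partial sums is constant once \<open>N > m\<close>. Convergence to \<open>f\<close> thus
  becomes a triangular system of finite equations for \<open>c\<close>.\<close>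

lemma unitriangular_sums_iff:
  fixes p :: "nat \<Rightarrow> 'a::comm_ring_1 fps"
  assumes "\<And>n m. m < n \<Longrightarrow> p n $ m = 0"
  shows "(\<lambda>n. fps_const (c n) * p n) sums f \<longleftrightarrow> (\<forall>m. f $ m = (\<Sum>n\<le>m. c n * p n $ m))"
proof -
  have "eventually (\<lambda>N. (\<Sum>n<N. fps_const (c n) * p n) $ m = f $ m) sequentially \<longleftrightarrow>
      f $ m = (\<Sum>n\<le>m. c n * p n $ m)" for m
  proof -
    have "eventually (\<lambda>N. (\<Sum>n<N. fps_const (c n) * p n) $ m = (\<Sum>n\<le>m. c n * p n $ m)) sequentially"
      using eventually_gt_at_top[of m]
      by eventually_elim (rule unitriangular_partial_sum_nth[OF assms])
    then have "eventually (\<lambda>N. (\<Sum>n<N. fps_const (c n) * p n) $ m = f $ m) sequentially \<longleftrightarrow>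
        eventually (\<lambda>N::nat. f $ m = (\<Sum>n\<le>m. c n * p n $ m)) sequentially"
      by (rule eventually_subst[OF eventually_mono]) auto
    then show ?thesis
      by simp
  qed
  then show ?thesis
    unfolding sums_def fps_tendsto_iff by simp
qed

text \<open>Forward substitution for this system; with ones on the diagonal no division occurs, so
  it works over any commutative ring.\<close>

fun triangular_coeffs :: "(nat \<Rightarrow> 'a::comm_ring_1 fps) \<Rightarrow> 'a fps \<Rightarrow> nat \<Rightarrow> 'a" where
  "triangular_coeffs p f m = f $ m - (\<Sum>n<m. triangular_coeffs p f n * p n $ m)"

declare triangular_coeffs.simps [simp del]

lemma unitriangular_pseudo_basis:
  fixes p :: "nat \<Rightarrow> 'a::comm_ring_1 fps"
  assumes below: "\<And>n m. m < n \<Longrightarrow> p n $ m = 0" and diag: "\<And>n. p n $ n = 1"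
  shows "pseudo_basis p"
proof -
  have split: "(\<Sum>n\<le>m. c n * p n $ m) = (\<Sum>n<m. c n * p n $ m) + c m" for c m
    by (simp add: lessThan_Suc_atMost[symmetric] diag)
  note sums_iff = unitriangular_sums_iff[of p, OF below]
  have "summable (\<lambda>n. fps_const (c n) * p n)" for c
    by (rule sums_summable[where l = "Abs_fps (\<lambda>m. \<Sum>n\<le>m. c n * p n $ m)"])
       (simp add: sums_iff)
  moreover have "\<exists>!c. (\<lambda>n. fps_const (c n) * p n) sums f" for f
  proof (rule ex1I)
    have "f $ m = (\<Sum>n<m. triangular_coeffs p f n * p n $ m) + triangular_coeffs p f m" for m
      by (simp add: triangular_coeffs.simps[of p f m])
    then show "(\<lambda>n. fps_const (triangular_coeffs p f n) * p n) sums f"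
      by (simp add: sums_iff split)
  next
    fix c assume c: "(\<lambda>n. fps_const (c n) * p n) sums f"
    have "c m = triangular_coeffs p f m" for m
    \<comment> \<open>The equation in degree \<open>m\<close> determines \<open>c m\<close> from the
      earlier coefficients.\<close>
    proof (induction m rule: less_induct)
      case (less m)
      have "c m = f $ m - (\<Sum>n<m. c n * p n $ m)"
        using c by (simp add: sums_iff split)
      also have "\<dots> = triangular_coeffs p f m"
        by (subst triangular_coeffs.simps) (simp add: less)
      finally show ?case .
    qed
    then show "c = triangular_coeffs p f" ..
  qed
  ultimately show ?thesis
    by (simp add: pseudo_basis_def)
qed

section \<open>Substitution of x + y as a ring homomorphism\<close>

lemma in_x_plus_y_nth: "in_x_plus_y f $ j $ i = of_nat ((i + j) choose i) * f $ (i + j)"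
proof -
  have "(\<Sum>n\<le>i + j. f $ n * ((var_x + var_y) ^ n $ j $ i)) =
      (\<Sum>n\<le>i + j. if n = i + j then f $ n * of_nat (n choose i) else 0)"
    by (intro sum.cong) (auto simp: var_x_plus_var_y_power_nth)
  then show ?thesis
    by (simp add: in_x_plus_y_def mult.commute)
qed

lemma in_x_plus_y_1: "in_x_plus_y 1 = 1"
  by (simp add: fps_eq_iff in_x_plus_y_nth)

text \<open>
  Up to total degree \<open>N\<close> the substituted series agree with polynomials in \<open>x + y\<close>, for which
  multiplicativity is the rule for adding exponents.
\<close>

lemma in_x_plus_y_mult:
  fixes f g :: "'a::comm_ring_1 fps"
  shows "in_x_plus_y (f * g) = in_x_plus_y f * in_x_plus_y g"
proof (intro fps_ext)
  fix j i :: nat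
  define S :: "'a fps fps" where "S = var_x + var_y"
  define N where "N = i + j"
  define P where "P h = (\<Sum>n\<le>N. fps_const (fps_const (h $ n)) * S ^ n)" for h :: "'a fps"
  have S: "S ^ n $ b $ a = (if n = a + b then of_nat (n choose a) else 0)" for n a b
    unfolding S_def by (rule var_x_plus_var_y_power_nth)
  have P: "P h $ b $ a = in_x_plus_y h $ b $ a" if "a + b \<le> N" for h a b
  proof -
    have "P h $ b $ a = (\<Sum>n\<le>N. if n = a + b then h $ n * of_nat (n choose a) else 0)"
      by (simp add: P_def fps_sum_nth S if_distrib cong: if_cong)
    then show ?thesis
      using that by (simp add: in_x_plus_y_nth mult.commute)
  qed
  \<comment> \<open>This coefficient involves only coefficients of the factors at indices
    \<open>b \<le> j\<close> and \<open>a \<le> i\<close>, hence of total degree at most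
    \<open>N\<close>, where \<open>P\<close> agrees with the substitution.\<close>
  have "(in_x_plus_y f * in_x_plus_y g) $ j $ i = (P f * P g) $ j $ i"
    by (auto simp: fps_mult_nth fps_sum_nth N_def intro!: sum.cong arg_cong2[where f = times] P[symmetric])
  also have "P f * P g = (\<Sum>m\<le>N. \<Sum>k\<le>N. fps_const (fps_const (f $ m * g $ k)) * S ^ (m + k))"
    by (simp add: P_def sum_product power_add mult_ac flip: fps_const_mult)
  \<comment> \<open>By homogeneity only exponents with \<open>m + k = N\<close> survive, which
    leaves the Cauchy product in degree \<open>N\<close>.\<close>
  also have "\<dots> $ j $ i =
      (\<Sum>m\<le>N. \<Sum>k\<le>N. if k = N - m then f $ m * g $ k * of_nat (N choose i) else 0)"
    unfolding fps_sum_nth fps_mult_left_const_nth S N_def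
    by (intro sum.cong refl) auto
  also have "\<dots> = of_nat (N choose i) * (f * g) $ N"
    by (simp add: fps_mult_nth sum_distrib_left sum_distrib_right mult_ac atLeast0AtMost)
  also have "\<dots> = in_x_plus_y (f * g) $ j $ i"
    by (simp add: in_x_plus_y_nth N_def)
  finally show "in_x_plus_y (f * g) $ j $ i = (in_x_plus_y f * in_x_plus_y g) $ j $ i" ..
qed

lemma in_x_plus_y_power: "in_x_plus_y (f ^ n) = in_x_plus_y f ^ n"
  by (induction n) (simp_all add: in_x_plus_y_1 in_x_plus_y_mult)

lemma in_x_power: "in_x (f ^ n) = in_x f ^ n"
  by (simp add: in_x_def)

lemma in_y_mult: "in_y (f * g) = in_y f * in_y g"
  by (simp add: fps_eq_iff in_y_def fps_mult_nth fps_sum_nth)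

lemma in_y_power: "in_y (f ^ n) = in_y f ^ n"
proof (induction n)
  case 0
  show ?case by (simp add: fps_eq_iff in_y_def)
qed (simp add: in_y_mult)

section \<open>The addition law of e and the binomial identity\<close>

context comm_rat_algebra
begin

lemma scale_mult_right: "scale q (x * y) = x * scale q y"
  by (metis mult.commute scale_mult_left)

lemma scale_mult_scale: "scale q x * scale r y = scale (q * r) (x * y)"
  by (simp add: mult.commute flip: scale_mult_left scale_mult_right)

lemma of_nat_mult_scale: "of_nat n * scale q x = scale (of_nat n * q) x"
  by (induction n) (simp_all add: algebra_simps)

lemma e_series_nth_0: "e_series scale l $ 0 = 0"
  by (simp add: e_series_def)

lemma e_series_nth_1: "e_series scale l $ Suc 0 = 1"
  by (simp add: e_series_def)

lemma e_series_power_nth_below: "m < n \<Longrightarrow> (e_series scale l ^ n) $ m = 0"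
  by (simp add: e_series_nth_0 startsby_zero_power_prefix)

lemma e_series_power_nth_diag: "(e_series scale l ^ n) $ n = 1"
  by (simp add: e_series_nth_0 e_series_nth_1 startsby_zero_power_nth_same)

text \<open>The addition law at mixed monomials. The factor \<open>l\<close> comes from (i + j) - 1
  = 1 + (i - 1) + (j - 1), which needs both indices positive.\<close>

lemma binomial_mult_e_series_nth:
  assumes "i > 0" "j > 0"
  shows "of_nat ((i + j) choose i) * e_series scale l $ (i + j) =
    l * (e_series scale l $ i * e_series scale l $ j)"
proof -
  have "of_nat ((i + j) choose i) * (1 / fact (i + j)) = 1 / fact i * (1 / fact j :: rat)"
    by (simp add: binomial_fact)
  moreover have "l ^ (i + j - 1) = l * (l ^ (i - 1) * l ^ (j - 1))"
    using assms by (cases i; cases j) (simp_all add: power_add)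
  ultimately have "scale (of_nat ((i + j) choose i) * (1 / fact (i + j))) (l ^ (i + j - 1)) =
      l * (scale (1 / fact i) (l ^ (i - 1)) * scale (1 / fact j) (l ^ (j - 1)))"
    by (simp only: scale_mult_scale scale_mult_right)
  then show ?thesis
    using assms by (simp add: e_series_def of_nat_mult_scale)
qed

text \<open>Since 1 + l * e(x) = exp(l * x), this is l-free form of the addition law of exp.
  Comparing coefficients avoids cancelling \<open>l\<close>, which may be zero or a zero
  divisor.\<close>

lemma in_x_plus_y_e_series:
  fixes l :: 'a
  defines "e \<equiv> e_series scale l"
  shows "in_x_plus_y e = in_x e + in_y e + fps_const (fps_const l) * (in_x e * in_y e)"
proof (intro fps_ext)
  fix j i :: nat
  \<comment> \<open>Pure powers come from \<open>in_x e\<close> and \<open>in_y e\<close>, mixed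
    monomials only from the product.\<close>
  consider "i = 0" | "j = 0" | "i > 0" "j > 0" by auto
  then show "in_x_plus_y e $ j $ i =
      (in_x e + in_y e + fps_const (fps_const l) * (in_x e * in_y e)) $ j $ i"
    by cases (simp_all add: in_x_plus_y_nth in_x_def in_y_def e_def e_series_nth_0
        binomial_mult_e_series_nth)
qed

end

lemma lambda_binomial_expansion:
  fixes a b c :: "'a::comm_ring_1"
  shows "(a + b + c * (a * b)) ^ n =
    (\<Sum>k=0..n. c ^ k *
      (\<Sum>i=0..n. of_nat (n choose i) * of_nat (i choose k) * a ^ (n + k - i) * b ^ i))"
proof -
  have "(a + b + c * (a * b)) ^ n = ((c * a + 1) * b + a) ^ n"
    by (simp add: algebra_simps)
  also have "\<dots> = (\<Sum>i\<le>n. of_nat (n choose i) * (c * a + 1) ^ i * b ^ i * a ^ (n - i))"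
    by (simp only: binomial_ring[of "(c * a + 1) * b"] power_mult_distrib mult.assoc)
  also have "\<dots> = (\<Sum>i\<le>n. \<Sum>k\<le>n. c ^ k *
      (of_nat (n choose i) * of_nat (i choose k) * a ^ (n + k - i) * b ^ i))"
  proof (rule sum.cong[OF refl])
    fix i assume i: "i \<in> {..n}"
    have "(c * a + 1) ^ i = (\<Sum>k\<le>i. of_nat (i choose k) * (c * a) ^ k)"
      by (simp add: binomial_ring)
    \<comment> \<open>The added terms have \<open>i choose k = 0\<close>; a range for
      \<open>k\<close> independent of \<open>i\<close> lets the two sums be swapped.\<close>
    also have "\<dots> = (\<Sum>k\<le>n. of_nat (i choose k) * (c * a) ^ k)"
      by (rule sum.mono_neutral_left) (use i in \<open>auto simp: not_le binomial_eq_0\<close>)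
    \<comment> \<open>The factor \<open>a ^ k\<close> stems from the inner expansion,
      \<open>a ^ (n - i)\<close> from the outer; \<open>i \<le> n\<close> keeps the subtraction from
      truncating.\<close>
    moreover have "a ^ (n + k - i) = a ^ k * a ^ (n - i)" for k
      using i by (simp add: add.commute flip: power_add)
    ultimately show "of_nat (n choose i) * (c * a + 1) ^ i * b ^ i * a ^ (n - i) =
        (\<Sum>k\<le>n. c ^ k * (of_nat (n choose i) * of_nat (i choose k) * a ^ (n + k - i) * b ^ i))"
      by (simp add: sum_distrib_left sum_distrib_right power_mult_distrib mult_ac)
  qed
  also have "\<dots> = (\<Sum>k\<le>n. \<Sum>i\<le>n. c ^ k *
      (of_nat (n choose i) * of_nat (i choose k) * a ^ (n + k - i) * b ^ i))"
    by (rule sum.swap)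
  finally show ?thesis
    by (simp add: sum_distrib_left atLeast0AtMost)
qed

theorem proposition4p3:
  fixes scale :: "rat \<Rightarrow> 'a::comm_ring_1 \<Rightarrow> 'a" and l :: 'a
  assumes "comm_rat_algebra scale"
  shows "pseudo_basis (\<lambda>n. e_series scale l ^ n) \<and>
         lambda_binomial_type l (\<lambda>n. e_series scale l ^ n)"
proof
  interpret comm_rat_algebra scale by (rule assms)
  show "pseudo_basis (\<lambda>n. e_series scale l ^ n)"
    by (intro unitriangular_pseudo_basis e_series_power_nth_below e_series_power_nth_diag)
  show "lambda_binomial_type l (\<lambda>n. e_series scale l ^ n)"
    \<comment> \<open>The expansion is used in the ring of double series with
      \<open>c = fps_const (fps_const l)\<close>, whose powers are again constants.\<close>
    unfolding lambda_binomial_type_def in_x_plus_y_power in_x_plus_y_e_series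
      in_x_power in_y_power lambda_binomial_expansion fps_const_power
    by simp
qed

end
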